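(* Let $G$ be a connected $\{P_6,\text{dart},K_4\}$-free graph with no clique cutset, and let $H$ be an induced diamond in $G$ with $V(H)=\{u_1,u_2,u_3,u_4\}$ and $E(H)=\{u_1u_2,u_2u_3,u_3u_4,u_4u_1,u_1u_3\}$. Let $A_2,B_{13},C_2,C_4,Z$ be as defined in the context, and assume $C_2=C_4=\emptyset$ and $B_{13}\neq\emptyset$. Put $W=V(H)\cup A_2\cup B_{13}\cup Z$. Then the graph $G[W]$ is $4$-colorable.
   Context: All graphs are finite, simple and undirected. $P_6$ is the path on $6$ vertices. A diamond is $K_4$ minus an edge; a dart is the graph obtained from a diamond by adding a new vertex adjacent to exactly one vertex of the diamond, that vertex being one of degree $3$ in the diamond. $\{P_6,\text{dart},K_4\}$-free means having no induced subgraph isomorphic to $P_6$, the dart, or $K_4$. A clique cutset of $G$ is a clique $K\subseteq V(G)$ such that $G\setminus K$ has more components than $G$. $G[X]$ is the subgraph induced by $X$. For $x\in V(G)\setminus V(H)$ write $N_H(x)=N(x)\cap V(H)$. Define $A_2=\{x\in V(G)\setminus V(H):N_H(x)=\{u_2\}\}$, $B_{13}=\{x\in V(G)\setminus V(H):N_H(x)=\{u_1,u_3\}\}$, $C_2=\{x\in V(G)\setminus V(H):N_H(x)=\{u_2,u_3,u_4\}\}$, $C_4=\{x\in V(G)\setminus V(H):N_H(x)=\{u_4,u_1,u_2\}\}$, $Z=\{x\in V(G)\setminus V(H):N_H(x)=\emptyset\}$. *)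

theory Defs
  imports
    "Graph_Theory.Digraph_Component"
    "Graph_Theory.Digraph_Isomorphism"
    "Graph_Theory.Kuratowski"
begin

text \<open>
  A finite simple undirected graph is a \<^locale>\<open>pair_graph\<close>: finite, loopless, without parallel arcs,
  and symmetric, so that an undirected edge is a pair of opposite arcs.
  The notions \<^const>\<open>induced_subgraph\<close>, \<^const>\<open>induce_subgraph\<close>, \<^const>\<open>digraph_iso\<close>,
  \<^const>\<open>complete_digraph\<close>, \<^const>\<open>Digraph_Component.connected\<close> and \<^const>\<open>pre_digraph.sccs\<close>
  are stated for general digraphs, whence the embedding \<^const>\<open>with_proj\<close>.
\<close>

text \<open>Each edge needs to be listed in one orientation only.\<close>

definition graph_of :: "'a set \<Rightarrow> ('a \<times> 'a) set \<Rightarrow> 'a pair_pre_digraph" where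
  "graph_of V E = mk_symmetric (with_proj \<lparr> pverts = V, parcs = E \<rparr>)"

definition path_graph :: "nat \<Rightarrow> nat pair_pre_digraph" where
  "path_graph n = graph_of {0..<n} {(i, Suc i) | i. Suc i < n}"

text \<open>A diamond when the four vertices are distinct; \<open>a\<close> and \<open>c\<close> are the vertices of degree 3.\<close>

definition diamond_graph :: "'a \<Rightarrow> 'a \<Rightarrow> 'a \<Rightarrow> 'a \<Rightarrow> 'a pair_pre_digraph" where
  "diamond_graph a b c d = graph_of {a, b, c, d} {(a, b), (b, c), (c, d), (d, a), (a, c)}"

definition dart_graph :: "nat pair_pre_digraph" where
  "dart_graph =
     graph_of (insert 4 (pverts (diamond_graph 0 1 2 3)))
              (insert (4, 0) (parcs (diamond_graph 0 1 2 3)))"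

definition induced_free :: "'b pair_pre_digraph \<Rightarrow> 'a pair_pre_digraph \<Rightarrow> bool" where
  "induced_free F G \<longleftrightarrow>
     \<not> (\<exists>H. induced_subgraph H (with_proj G) \<and> digraph_iso H (with_proj F))"

text \<open>For \<open>K\<^sub>4\<close> no isomorphism is needed: \<^const>\<open>complete_digraph\<close> is a predicate on graphs
  which is closed under isomorphism.\<close>

definition P6_dart_K4_free :: "'a pair_pre_digraph \<Rightarrow> bool" where
  "P6_dart_K4_free G \<longleftrightarrow>
     induced_free (path_graph 6) G \<and> induced_free dart_graph G \<and>
     \<not> (\<exists>H. induced_subgraph H (with_proj G) \<and> complete_digraph 4 H)"

definition is_clique :: "'a pair_pre_digraph \<Rightarrow> 'a set \<Rightarrow> bool" where
  "is_clique G K \<longleftrightarrow> K \<subseteq> pverts G \<and> (\<forall>u \<in> K. \<forall>v \<in> K. u \<noteq> v \<longrightarrow> (u, v) \<in> parcs G)"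

text \<open>In a symmetric digraph the strongly connected components are the components of the
  undirected graph.\<close>

definition num_components :: "('a, 'b) pre_digraph \<Rightarrow> nat" where
  "num_components G = card (pre_digraph.sccs G)"

definition clique_cutset :: "'a pair_pre_digraph \<Rightarrow> 'a set \<Rightarrow> bool" where
  "clique_cutset G K \<longleftrightarrow> is_clique G K \<and>
     num_components (induce_subgraph (with_proj G) (pverts G - K)) > num_components (with_proj G)"

definition nbhd :: "'a pair_pre_digraph \<Rightarrow> 'a \<Rightarrow> 'a set" where
  "nbhd G x = {y. (x, y) \<in> parcs G}"

text \<open>The set of all \<open>x \<in> V(G) \<setminus> V(H)\<close> with \<open>N\<^sub>H(x) = S\<close>.\<close>

definition attached :: "'a pair_pre_digraph \<Rightarrow> 'a pair_pre_digraph \<Rightarrow> 'a set \<Rightarrow> 'a set" where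
  "attached G H S = {x \<in> pverts G - pverts H. nbhd G x \<inter> pverts H = S}"

definition colorable :: "nat \<Rightarrow> ('a, 'b) pre_digraph \<Rightarrow> bool" where
  "colorable k G \<longleftrightarrow>
     (\<exists>c :: 'a \<Rightarrow> nat. c ` verts G \<subseteq> {0..<k} \<and> (\<forall>e \<in> arcs G. c (tail G e) \<noteq> c (head G e)))"

end

theory Submission
  imports Defs
begin

text \<open>
  Let \<open>D = {u2} \<union> B13\<close> and \<open>R = A2 \<union> Z\<close>. The vertices of \<open>D\<close> are common neighbours of \<open>u1\<close> and
  \<open>u3\<close>, so \<open>D\<close> is independent, and \<open>u4\<close> has no neighbour in \<open>D\<close>; neither \<open>u1\<close> nor \<open>u3\<close> nor \<open>u4\<close>
  has a neighbour in \<open>R\<close>. Give \<open>u1\<close>, \<open>u3\<close> and the set \<open>D \<union> {u4}\<close> the colours \<open>0\<close>, \<open>1\<close> and \<open>3\<close>. It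
  remains to colour every component \<open>K\<close> of \<open>G[R]\<close> with \<open>0, \<dots>, 3\<close> so that colour \<open>3\<close> is not
  used on the set \<open>M\<close> of vertices with a neighbour in \<open>D\<close>.

  Suppose that \<open>d \<in> D\<close> has a neighbour in \<open>K\<close>. The first two vertices of the induced path
  \<open>u4, u1, d\<close> have no neighbour in \<open>K\<close>. As there is no induced \<open>P\<^sub>6\<close>, each vertex of
  \<open>K \<inter> N(d)\<close> is complete or anticomplete to each component of \<open>K \<setminus> N(d)\<close>; as there is no
  dart and no \<open>K\<^sub>4\<close>, both
  \<open>K \<inter> N(d)\<close> and \<open>K \<setminus> N(d)\<close> induce graphs of maximum degree at most \<open>1\<close>. Colours \<open>0, 1\<close> on
  the former and \<open>2, 3\<close> on the latter do, unless some edge \<open>ab\<close> of \<open>K \<setminus> N(d)\<close> has both ends in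
  \<open>M\<close> (lemma \<open>four_colouring\<close>). In that case \<open>K\<close> is 3-colourable. Take \<open>d' \<in> D\<close> adjacent to
  \<open>a\<close>. If \<open>d'\<close> is not adjacent to \<open>b\<close>, then \<open>K\<close> turns out to be a triangle
  (\<open>three_colouring_half_seen_edge\<close>). If it is, then the partition of \<open>K\<close> by adjacency to \<open>d\<close> and
  to \<open>d'\<close> is so restricted that a 3-colouring can be written down (\<open>three_colouring_seen_edge\<close>).

  If no vertex of \<open>D\<close> has a neighbour in \<open>K\<close>, then \<open>M \<inter> K\<close> is empty, and a vertex \<open>s\<close> outside
  \<open>K\<close> with a neighbour in \<open>K\<close> exists since \<open>G\<close> is connected. Because \<open>B13\<close> is nonempty and
  \<open>C2\<close>, \<open>C4\<close> are empty, such an \<open>s\<close> is adjacent to \<open>u4\<close> and not to \<open>u1\<close>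
  (\<open>centre_nbr_adj_leaves\<close>), and \<open>four_colouring\<close> applies to the induced path \<open>u1, u4, s\<close>.
\<close>

section \<open>Matchings and their 2-colourings\<close>

text \<open>The graph induced on \<open>S\<close> has maximum degree at most \<open>1\<close>: its edges form a matching.\<close>

definition matching_on :: "('a \<Rightarrow> 'a \<Rightarrow> bool) \<Rightarrow> 'a set \<Rightarrow> bool" where
  "matching_on E S \<longleftrightarrow> (\<forall>x\<in>S. \<forall>y\<in>S. \<forall>z\<in>S. E y x \<longrightarrow> E y z \<longrightarrow> x = z)"

lemma matching_onD:
  "matching_on E S \<Longrightarrow> x \<in> S \<Longrightarrow> y \<in> S \<Longrightarrow> z \<in> S \<Longrightarrow> E y x \<Longrightarrow> E y z \<Longrightarrow> x = z"
  by (auto simp: matching_on_def)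

text \<open>The colour \<open>False\<close> can be prescribed on any set \<open>M\<close> whose part in \<open>S\<close> is independent.\<close>

lemma matching_2_colouring:
  assumes sym: "\<And>x y. E x y \<Longrightarrow> E y x" and irr: "\<And>x. \<not> E x x"
    and mat: "matching_on E S"
    and ind: "\<And>x y. x \<in> M \<Longrightarrow> y \<in> M \<Longrightarrow> x \<in> S \<Longrightarrow> y \<in> S \<Longrightarrow> \<not> E x y"
  shows "\<exists>f :: 'a \<Rightarrow> bool. (\<forall>x\<in>S. \<forall>y\<in>S. E x y \<longrightarrow> f x \<noteq> f y) \<and> (\<forall>x\<in>S \<inter> M. \<not> f x)"
proof -
  \<comment> \<open>\<open>blk v\<close> is the component of \<open>v\<close>; \<open>f\<close> is false at one chosen vertex of each component, taken
    from \<open>M\<close> whenever possible.\<close>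
  define blk where "blk v = {w \<in> S. w = v \<or> E v w}" for v
  define pick where "pick B = (SOME x. x \<in> B \<and> (B \<inter> M \<noteq> {} \<longrightarrow> x \<in> M))" for B
  define f where "f v \<longleftrightarrow> pick (blk v) \<noteq> v" for v
  have pick: "pick (blk v) \<in> blk v \<and> (blk v \<inter> M \<noteq> {} \<longrightarrow> pick (blk v) \<in> M)" if "v \<in> S" for v
  proof -
    have "v \<in> blk v" using that by (simp add: blk_def)
    then have "\<exists>x. x \<in> blk v \<and> (blk v \<inter> M \<noteq> {} \<longrightarrow> x \<in> M)" by blast
    then show ?thesis unfolding pick_def by (rule someI_ex)
  qed
  have "f x \<noteq> f y" if xy: "x \<in> S" "y \<in> S" "E x y" for x y
  proof -
    have "blk x = {x, y}" "blk y = {x, y}"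
      using matching_onD[OF mat] xy sym[OF xy(3)] by (auto simp: blk_def)
    then have "blk y = blk x" "pick (blk x) = x \<or> pick (blk x) = y"
      using pick[OF xy(1)] by auto
    moreover have "x \<noteq> y" using xy irr by auto
    ultimately show ?thesis by (auto simp: f_def)
  qed
  moreover have "\<not> f x" if x: "x \<in> S" "x \<in> M" for x
  proof -
    have "x \<in> blk x \<inter> M" using x by (simp add: blk_def)
    then have "pick (blk x) \<in> blk x" "pick (blk x) \<in> M" using pick[OF x(1)] by auto
    then show ?thesis using ind x by (auto simp: f_def blk_def)
  qed
  ultimately show ?thesis by blast
qed

section \<open>Connected sets of vertices\<close>

text \<open>The graph induced on \<open>K\<close> is connected: no proper nonempty subset of \<open>K\<close> is closed under
  adjacency within \<open>K\<close>. The empty set counts as connected.\<close>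

definition connected_on :: "('a \<Rightarrow> 'a \<Rightarrow> bool) \<Rightarrow> 'a set \<Rightarrow> bool" where
  "connected_on E K \<longleftrightarrow>
    (\<forall>A \<subseteq> K. A \<noteq> {} \<longrightarrow> (\<forall>x\<in>A. \<forall>y\<in>K. E x y \<longrightarrow> y \<in> A) \<longrightarrow> A = K)"

lemma connected_onD:
  assumes "connected_on E K" "A \<subseteq> K" "A \<noteq> {}" "\<And>x y. x \<in> A \<Longrightarrow> y \<in> K \<Longrightarrow> E x y \<Longrightarrow> y \<in> A"
  shows "A = K"
  using assms unfolding connected_on_def by blast

text \<open>The predicate \<open>P\<close> restricts the colours admissible at each vertex.\<close>

lemma colouring_by_components:
  assumes sym: "\<And>x y. E x y \<Longrightarrow> E y x"
    and comp: "\<And>K. \<lbrakk>K \<subseteq> R; K \<noteq> {}; connected_on E K; \<And>x y. x \<in> K \<Longrightarrow> y \<in> R \<Longrightarrow> E x y \<Longrightarrow> y \<in> K\<rbrakk>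
      \<Longrightarrow> \<exists>c :: 'a \<Rightarrow> 'b. (\<forall>x\<in>K. P x (c x)) \<and> (\<forall>x\<in>K. \<forall>y\<in>K. E x y \<longrightarrow> c x \<noteq> c y)"
  shows "\<exists>c :: 'a \<Rightarrow> 'b. (\<forall>x\<in>R. P x (c x)) \<and> (\<forall>x\<in>R. \<forall>y\<in>R. E x y \<longrightarrow> c x \<noteq> c y)"
proof -
  define r where "r = {(x, y). x \<in> R \<and> y \<in> R \<and> E x y}"
  define cmp where "cmp v = r\<^sup>* `` {v}" for v
  have "sym r" using sym by (auto simp: r_def intro: symI)
  then have symr: "(y, x) \<in> r\<^sup>*" if "(x, y) \<in> r\<^sup>*" for x y
    using that by (meson sym_rtrancl symE)
  have eq: "cmp w = cmp v" if "(v, w) \<in> r\<^sup>*" for v w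
    using that symr[OF that] by (auto simp: cmp_def intro: rtrancl_trans)
  have sub: "w \<in> R" if "v \<in> R" "(v, w) \<in> r\<^sup>*" for v w
    using that(2,1) by (induction) (auto simp: r_def)
  have "\<forall>K\<in>cmp ` R. \<exists>c :: 'a \<Rightarrow> 'b. (\<forall>x\<in>K. P x (c x)) \<and>
    (\<forall>x\<in>K. \<forall>y\<in>K. E x y \<longrightarrow> c x \<noteq> c y)"
  proof
    fix K assume "K \<in> cmp ` R"
    then obtain v where v: "v \<in> R" "K = cmp v" by blast
    show "\<exists>c :: 'a \<Rightarrow> 'b. (\<forall>x\<in>K. P x (c x)) \<and> (\<forall>x\<in>K. \<forall>y\<in>K. E x y \<longrightarrow> c x \<noteq> c y)"
    proof (rule comp)
      show KR: "K \<subseteq> R" using sub v by (auto simp: cmp_def)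
      show "K \<noteq> {}" using v by (auto simp: cmp_def)
      show closed: "y \<in> K" if "x \<in> K" "y \<in> R" "E x y" for x y
        using that v KR by (auto simp: cmp_def r_def intro: rtrancl_into_rtrancl)
      show "connected_on E K" unfolding connected_on_def
      proof (intro allI impI)
        fix A assume A: "A \<subseteq> K" "A \<noteq> {}" "\<forall>x\<in>A. \<forall>y\<in>K. E x y \<longrightarrow> y \<in> A"
        then obtain a where a: "a \<in> A" by blast
        have "w \<in> A" if "(a, w) \<in> r\<^sup>*" for w
          using that
        proof induction
          case (step y z)
          then have "y \<in> K" "z \<in> R" "E y z" using A(1) by (auto simp: r_def)
          then show ?case using closed A(3) step by blast
        qed (fact a)
        moreover have "K = cmp a" using eq[of v a] a A(1) v by (auto simp: cmp_def)
        ultimately show "A = K" using A(1) by (auto simp: cmp_def)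
      qed
    qed
  qed
  from bchoice[OF this] obtain C :: "'a set \<Rightarrow> 'a \<Rightarrow> 'b" where
    C: "\<forall>K\<in>cmp ` R. (\<forall>x\<in>K. P x (C K x)) \<and> (\<forall>x\<in>K. \<forall>y\<in>K. E x y \<longrightarrow> C K x \<noteq> C K y)"
    by blast
  have self: "v \<in> cmp v" for v by (simp add: cmp_def)
  have "P x (C (cmp x) x)" if "x \<in> R" for x using that C self by blast
  moreover have "C (cmp x) x \<noteq> C (cmp y) y" if "x \<in> R" "y \<in> R" "E x y" for x y
  proof -
    have "cmp y = cmp x" using that by (intro eq r_into_rtrancl) (simp add: r_def)
    then show ?thesis using C that self[of x] self[of y] by (metis imageI)
  qed
  ultimately show ?thesis by (intro exI[of _ "\<lambda>v. C (cmp v) v"]) blast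
qed

section \<open>Forbidden subgraphs and rooted components\<close>

text \<open>The adjacency relation of a graph without induced \<open>P\<^sub>6\<close>, dart or \<open>K\<^sub>4\<close>. The path is
  \<open>a, b, c, d, e, f\<close>; its adjacencies and nonadjacencies already force the six vertices to be
  distinct. In the dart, \<open>p\<close> and \<open>q\<close> are the vertices of degree 3 of the diamond, \<open>r\<close> and \<open>s\<close> the
  other two, and \<open>t\<close> is the pendant vertex, attached to \<open>p\<close>.\<close>

locale P6_dart_K4_free_adj =
  fixes adj :: "'a \<Rightarrow> 'a \<Rightarrow> bool" (infix "\<sim>" 50)
  assumes sym: "x \<sim> y \<Longrightarrow> y \<sim> x"
    and irrefl: "\<not> x \<sim> x"
    and no_P6: "\<lbrakk>a \<sim> b; b \<sim> c; c \<sim> d; d \<sim> e; e \<sim> f;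
      \<not> a \<sim> c; \<not> a \<sim> d; \<not> a \<sim> e; \<not> a \<sim> f; \<not> b \<sim> d; \<not> b \<sim> e; \<not> b \<sim> f;
      \<not> c \<sim> e; \<not> c \<sim> f; \<not> d \<sim> f\<rbrakk> \<Longrightarrow> False"
    and no_dart: "\<lbrakk>p \<sim> q; p \<sim> r; p \<sim> s; q \<sim> r; q \<sim> s; r \<noteq> s; \<not> r \<sim> s;
      p \<sim> t; \<not> t \<sim> q; \<not> t \<sim> r; \<not> t \<sim> s\<rbrakk> \<Longrightarrow> False"
    and no_K4: "\<lbrakk>p \<sim> q; p \<sim> r; p \<sim> s; q \<sim> r; q \<sim> s; r \<sim> s\<rbrakk> \<Longrightarrow> False"
begin

lemma sym_iff: "x \<sim> y \<longleftrightarrow> y \<sim> x"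
  using sym by blast

text \<open>The neighbourhood of a vertex \<open>v\<close> contains no path \<open>x, y, z\<close>, induced or not, if \<open>v\<close> has
  a further neighbour \<open>t\<close> that sees no vertex of the path: an induced path would yield a dart with
  pendant vertex \<open>t\<close>, and a triangle would yield a \<open>K\<^sub>4\<close>.\<close>

lemma no_path_in_nbhd:
  assumes "v \<sim> x" "v \<sim> y" "v \<sim> z" "y \<sim> x" "y \<sim> z"
    and "v \<sim> t" "\<not> t \<sim> x" "\<not> t \<sim> y" "\<not> t \<sim> z"
  shows "x = z"
  using no_dart[of v y x z t] no_K4[of v y x z] assms by blast

end

text \<open>A set \<open>K\<close> that induces a connected subgraph, hanging on a root \<open>d\<close> at the end of an
  induced path \<open>p, q, d\<close> whose first two vertices have no neighbour in \<open>K\<close>.\<close>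

locale rooted_component = P6_dart_K4_free_adj +
  fixes p q d :: 'a and K :: "'a set"
  assumes pq: "p \<sim> q" and qd: "q \<sim> d" and pd: "\<not> p \<sim> d"
    and pK: "k \<in> K \<Longrightarrow> \<not> p \<sim> k" and qK: "k \<in> K \<Longrightarrow> \<not> q \<sim> k"
    and conn: "connected_on adj K"
    and touch: "\<exists>k\<in>K. d \<sim> k"
begin

text \<open>Otherwise \<open>p, q, d, x, y, z\<close> is an induced \<open>P\<^sub>6\<close>.\<close>

lemma absorb:
  assumes "x \<in> K" "d \<sim> x" "y \<in> K" "\<not> d \<sim> y" "z \<in> K" "\<not> d \<sim> z" "x \<sim> y" "y \<sim> z"
  shows "x \<sim> z"
  using no_P6[of p q d x y z] pq qd pd pK qK assms by blast

lemma dominated: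
  assumes "k \<in> K" "\<not> d \<sim> k"
  shows "\<exists>x\<in>K. d \<sim> x \<and> x \<sim> k"
proof -
  let ?A = "{y\<in>K. d \<sim> y \<or> (\<exists>x\<in>K. d \<sim> x \<and> x \<sim> y)}"
  have "?A = K"
  proof (rule connected_onD[OF conn])
    show "?A \<noteq> {}" using touch by blast
    fix y z assume "y \<in> ?A" "z \<in> K" "y \<sim> z"
    then show "z \<in> ?A" using absorb by blast
  qed auto
  then show ?thesis using assms by blast
qed

lemma matching_nbrs: "matching_on adj {k\<in>K. d \<sim> k}"
  unfolding matching_on_def
proof (intro ballI impI)
  fix x y z assume "x \<in> {k\<in>K. d \<sim> k}" "y \<in> {k\<in>K. d \<sim> k}" "z \<in> {k\<in>K. d \<sim> k}" "y \<sim> x" "y \<sim> z"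
  then show "x = z" using no_path_in_nbhd[of d x y z q] qd qK sym by blast
qed

lemma matching_non_nbrs: "matching_on adj {k\<in>K. \<not> d \<sim> k}"
  unfolding matching_on_def
proof (intro ballI impI)
  fix x y z assume h: "x \<in> {k\<in>K. \<not> d \<sim> k}" "y \<in> {k\<in>K. \<not> d \<sim> k}" "z \<in> {k\<in>K. \<not> d \<sim> k}"
    "y \<sim> x" "y \<sim> z"
  then obtain w where w: "w \<in> K" "d \<sim> w" "w \<sim> y" using dominated by blast
  \<comment> \<open>so \<open>x, y, z\<close> lie in the neighbourhood of \<open>w\<close>, and \<open>d\<close> is a further neighbour of \<open>w\<close>\<close>
  then have "w \<sim> x" "w \<sim> z" using h absorb[of w y] by auto
  then show "x = z" using no_path_in_nbhd[of w x y z d] w h sym by blast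
qed

text \<open>A 4-colouring that avoids colour \<open>3\<close> on \<open>M\<close> exists if no edge outside \<open>N(d)\<close> has
  both ends in \<open>M\<close>.\<close>

lemma four_colouring:
  assumes "\<And>x y. \<lbrakk>x \<in> K; y \<in> K; \<not> d \<sim> x; \<not> d \<sim> y; x \<in> M; y \<in> M\<rbrakk> \<Longrightarrow> \<not> x \<sim> y"
  shows "\<exists>c :: 'a \<Rightarrow> nat. (\<forall>x\<in>K. c x < 4 \<and> (x \<in> M \<longrightarrow> c x < 3)) \<and>
    (\<forall>x\<in>K. \<forall>y\<in>K. x \<sim> y \<longrightarrow> c x \<noteq> c y)"
proof -
  obtain f :: "'a \<Rightarrow> bool"
    where f: "\<forall>x\<in>{k\<in>K. d \<sim> k}. \<forall>y\<in>{k\<in>K. d \<sim> k}. x \<sim> y \<longrightarrow> f x \<noteq> f y"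
    using matching_2_colouring[OF sym irrefl matching_nbrs, of "{}"] by auto
  have "\<not> x \<sim> y" if "x \<in> M" "y \<in> M" "x \<in> {k\<in>K. \<not> d \<sim> k}" "y \<in> {k\<in>K. \<not> d \<sim> k}" for x y
    using assms that by simp
  from matching_2_colouring[OF sym irrefl matching_non_nbrs this, of M]
  obtain g :: "'a \<Rightarrow> bool"
    where g: "\<forall>x\<in>{k\<in>K. \<not> d \<sim> k}. \<forall>y\<in>{k\<in>K. \<not> d \<sim> k}. x \<sim> y \<longrightarrow> g x \<noteq> g y"
      "\<forall>x\<in>{k\<in>K. \<not> d \<sim> k} \<inter> M. \<not> g x"
    by auto
  let ?c = "\<lambda>x. if d \<sim> x then (if f x then 1 else 0) else (if g x then 3 else 2 :: nat)"
  show ?thesis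
    using f g by (intro exI[of _ ?c]) auto
qed

end

section \<open>Two roots of one component\<close>

text \<open>Two nonadjacent roots \<open>d\<close> and \<open>d'\<close> attached to the same induced path \<open>p, q\<close>; both have
  neighbours in \<open>K\<close>.\<close>

locale two_roots =
  rooted_component adj p q d K + other: rooted_component adj p q d' K
  for adj :: "'a \<Rightarrow> 'a \<Rightarrow> bool" (infix "\<sim>" 50) and p q d d' K +
  assumes distinct_roots: "d \<noteq> d'" and dd': "\<not> d \<sim> d'"
begin

lemma swap: "two_roots adj p q d' d K"
  by unfold_locales (use dd' distinct_roots sym in blast)+

text \<open>Let \<open>ab\<close> be an edge avoiding \<open>N(d)\<close> such that \<open>d'\<close> sees \<open>a\<close> but not \<open>b\<close>. A neighbour \<open>k\<close> of
  \<open>d\<close> that sees \<open>a\<close> and \<open>d'\<close> would give a dart with diamond \<open>k, a, b, d'\<close> and pendant vertex \<open>d\<close>;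
  one that sees neither would give the induced path \<open>b, a, d', q, d, k\<close>.\<close>

lemma half_seen_edge:
  assumes ab: "a \<in> K" "b \<in> K" "a \<sim> b" "\<not> d \<sim> a" "\<not> d \<sim> b" "d' \<sim> a" "\<not> d' \<sim> b"
    and k: "k \<in> K" "d \<sim> k"
  shows "k \<sim> a \<longleftrightarrow> \<not> d' \<sim> k"
proof
  assume ka: "k \<sim> a"
  then have "k \<sim> b" using absorb[of k a b] ab k by blast
  moreover have "b \<noteq> d'" using other.qd qK ab by blast
  ultimately show "\<not> d' \<sim> k" using no_dart[of k a b d' d] ka ab k dd' by (metis sym)
next
  assume n: "\<not> d' \<sim> k"
  show "k \<sim> a"
  proof (rule ccontr)
    assume ka: "\<not> k \<sim> a"
    then have kb: "\<not> k \<sim> b" using absorb[of k b a] ab k sym by blast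
    show False
      by (rule no_P6[of b a d' q d k])
        (use ka kb ab k n qd qK other.qd dd' in \<open>auto dest: sym\<close>)
  qed
qed

lemma half_seen_edge_unique:
  assumes ab: "a \<in> K" "b \<in> K" "a \<sim> b" "\<not> d \<sim> a" "\<not> d \<sim> b" "d' \<sim> a" "\<not> d' \<sim> b"
    and x: "x \<in> K" "d \<sim> x" "\<not> d' \<sim> x" and y: "y \<in> K" "d \<sim> y" "\<not> d' \<sim> y"
  shows "x = y"
proof -
  have "x \<sim> a" "y \<sim> a" using half_seen_edge[OF ab] x y by auto
  then have "x \<sim> b" "y \<sim> b" using absorb[of _ a b] ab x y by auto
  then show ?thesis
    using matching_onD[OF other.matching_non_nbrs, of x b y] ab x y sym by blast
qed

text \<open>With \<open>x\<close> a common neighbour of \<open>d\<close>, \<open>a\<close> and \<open>b\<close>, the edge \<open>xb\<close> relates to \<open>d', d\<close> as \<open>ab\<close>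
  does to \<open>d, d'\<close>. The two applications of the preceding lemmas show that the triangle \<open>a, b, x\<close>
  is all of \<open>K\<close>.\<close>

lemma three_colouring_half_seen_edge:
  assumes ab: "a \<in> K" "b \<in> K" "a \<sim> b" "\<not> d \<sim> a" "\<not> d \<sim> b" "d' \<sim> a" "\<not> d' \<sim> b"
  shows "\<exists>c :: 'a \<Rightarrow> nat. (\<forall>x\<in>K. c x < 3) \<and> (\<forall>x\<in>K. \<forall>y\<in>K. x \<sim> y \<longrightarrow> c x \<noteq> c y)"
proof -
  interpret swap: two_roots adj p q d' d K by (rule swap)
  obtain x where x: "x \<in> K" "d \<sim> x" "x \<sim> a" using dominated ab by blast
  then have xb: "x \<sim> b" using absorb[of x a b] ab by blast
  have xd': "\<not> d' \<sim> x" using half_seen_edge[OF ab] x by blast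
  have swapped: "x \<in> K" "b \<in> K" "x \<sim> b" "\<not> d' \<sim> x" "\<not> d' \<sim> b" "d \<sim> x" "\<not> d \<sim> b"
    using x xb xd' ab by auto
  note uniq = half_seen_edge_unique[OF ab] and uniq' = swap.half_seen_edge_unique[OF swapped]
  note half = half_seen_edge[OF ab] and half' = swap.half_seen_edge[OF swapped]
  note out = matching_onD[OF matching_non_nbrs] and out' = matching_onD[OF other.matching_non_nbrs]
  have "{a, b, x} = K"
  proof (rule connected_onD[OF conn])
    fix v w assume v: "v \<in> {a, b, x}" and w: "w \<in> K" "v \<sim> w"
    consider "v = a" | "v = b" | "v = x" using v by blast
    then show "w \<in> {a, b, x}"
    proof cases
      case 1
      show ?thesis
      proof (cases "d \<sim> w")
        case True
        then show ?thesis using half[of w] uniq[of w x] w 1 x xd' sym by blast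
      next
        case False
        then show ?thesis using out[of w a b] w 1 ab by blast
      qed
    next
      case 2
      show ?thesis
      proof (cases "d \<sim> w")
        case True
        then have "w \<sim> a" using absorb[of w b a] w 2 ab sym by blast
        then show ?thesis using True half[of w] uniq[of w x] w x xd' by blast
      next
        case False
        then show ?thesis using out[of w b a] w 2 ab sym by blast
      qed
    next
      case 3
      show ?thesis
      proof (cases "d' \<sim> w")
        case True
        then show ?thesis using half'[of w] uniq'[of w a] w 3 ab sym by blast
      next
        case False
        then show ?thesis using out'[of w x b] w 3 xb x xd' ab sym by blast
      qed
    qed
  qed (use ab x in auto)
  moreover have "a \<noteq> b" "a \<noteq> x" "b \<noteq> x" using ab x xb irrefl by auto
  ultimately show ?thesis
    using irrefl by (intro exI[of _ "\<lambda>v. if v = a then 0 else if v = b then 1 else 2"]) auto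
qed

text \<open>The partition of \<open>K\<close> by adjacency to \<open>d\<close> and to \<open>d'\<close>.\<close>

definition both where "both = {k\<in>K. d \<sim> k \<and> d' \<sim> k}"
definition only1 where "only1 = {k\<in>K. d \<sim> k \<and> \<not> d' \<sim> k}"
definition only2 where "only2 = {k\<in>K. \<not> d \<sim> k \<and> d' \<sim> k}"
definition neither where "neither = {k\<in>K. \<not> d \<sim> k \<and> \<not> d' \<sim> k}"

lemmas parts_defs = both_def only1_def only2_def neither_def

lemma matching_parts:
  "matching_on adj both" "matching_on adj only1" "matching_on adj only2" "matching_on adj neither"
  using matching_nbrs matching_non_nbrs unfolding matching_on_def parts_defs by blast+

text \<open>The vertex \<open>x\<close> has no neighbour in \<open>S\<close>; used for \<open>x \<in> S\<close>, where it says that \<open>x\<close> is isolated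
  in the graph induced on \<open>S\<close>.\<close>

definition single :: "'a set \<Rightarrow> 'a \<Rightarrow> bool" where
  "single S x \<longleftrightarrow> (\<forall>y\<in>S. \<not> x \<sim> y)"

lemma part_2_colouring:
  assumes "matching_on adj S"
  shows "\<exists>f :: 'a \<Rightarrow> bool. (\<forall>x\<in>S. \<forall>y\<in>S. x \<sim> y \<longrightarrow> f x \<noteq> f y) \<and>
    (\<forall>x\<in>S. f x \<longrightarrow> \<not> single S x)"
proof -
  have "\<not> x \<sim> y" if "x \<in> {x. single S x}" "y \<in> {x. single S x}" "x \<in> S" "y \<in> S" for x y
    using that by (auto simp: single_def)
  from matching_2_colouring[OF sym irrefl assms this, of "{x. single S x}"] show ?thesis by auto
qed

lemma single_only1_if_adj_both:
  assumes "x \<in> only1" "w \<in> both" "x \<sim> w"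
  shows "single only1 x" "single both w"
proof -
  note m = matching_onD[OF matching_nbrs]
  show "single only1 x"
    unfolding single_def using m[of w x] assms by (auto simp: parts_defs)
  show "single both w"
    unfolding single_def using m[of x w] assms sym by (auto simp: parts_defs)
qed

lemma neither_both_not_both_paired:
  assumes "z \<in> neither" "w \<in> both" "z \<sim> w"
  shows "single neither z \<or> single both w"
proof (rule ccontr)
  assume "\<not> ?thesis"
  then obtain z' w' where h: "z' \<in> neither" "w' \<in> both" "z \<sim> z'" "w \<sim> w'"
    by (auto simp: single_def)
  have wz': "w \<sim> z'" using absorb[of w z z'] assms h sym by (auto simp: parts_defs)
  have "z \<sim> w'"
    \<comment> \<open>otherwise \<open>z\<close> is a pendant at \<open>w\<close> of the diamond on \<open>d, d', w, w'\<close>\<close>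
    using no_dart[of w w' d d' z] assms h dd' distinct_roots sym unfolding parts_defs by blast
  then have "z' \<sim> w'" using absorb[of w' z z'] assms h sym by (auto simp: parts_defs)
  then show False using no_K4[of z z' w w'] assms h wz' \<open>z \<sim> w'\<close> sym by blast
qed

text \<open>Matching edges in \<open>only1\<close> and \<open>only2\<close> with adjacent ends are complete to each other and
  span a \<open>K\<^sub>4\<close>.\<close>

lemma only1_only2_not_both_paired:
  assumes "x \<in> only1" "y \<in> only2" "x \<sim> y"
  shows "single only1 x \<or> single only2 y"
proof (rule ccontr)
  assume "\<not> ?thesis"
  then obtain x' y' where h: "x' \<in> only1" "y' \<in> only2" "x \<sim> x'" "y \<sim> y'"
    by (auto simp: single_def)
  have "x \<sim> y'" using absorb[of x y y'] assms h by (auto simp: parts_defs)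
  moreover have "y \<sim> x'" using other.absorb[of y x x'] assms h sym by (auto simp: parts_defs)
  moreover have "x' \<sim> y'"
    using absorb[of x' y y'] assms h \<open>y \<sim> x'\<close> sym by (auto simp: parts_defs)
  ultimately show False using no_K4[of x x' y y'] assms h sym by blast
qed

text \<open>Here the edge \<open>ab\<close> avoids \<open>N(d)\<close> and lies in \<open>N(d')\<close>. Suppose that \<open>kz\<close> is an edge as
  excluded. If \<open>k\<close> is seen by \<open>d\<close> only, then it cannot see \<open>a\<close>, for otherwise \<open>a\<close> would see \<open>z\<close>,
  against the matching property outside \<open>N(d)\<close>; so \<open>z, k, d, q, d', a\<close> is an induced path. If \<open>k\<close>
  is seen by \<open>d'\<close> only, the induced path is \<open>z, k, d', q, d, x\<close> with \<open>x\<close> seen by \<open>d\<close> only.\<close>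

lemma not_adj_neither:
  assumes ab: "a \<in> only2" "b \<in> only2" "a \<sim> b" and z: "z \<in> neither"
  shows "k \<in> only1 \<Longrightarrow> \<not> k \<sim> z" and "k \<in> only2 \<Longrightarrow> \<not> k \<sim> z"
proof -
  note out = matching_onD[OF matching_non_nbrs]
  have az: "\<not> a \<sim> z"
    using out[of b a z] ab z by (auto simp: parts_defs)
  have A: "\<not> k \<sim> z" if k: "k \<in> only1" for k
  proof
    assume kz: "k \<sim> z"
    have "\<not> a \<sim> k" using az other.absorb[of a k z] ab z k kz by (auto simp: parts_defs)
    then show False
      using no_P6[of z k d q d' a] ab k z kz az qd qK other.qd dd' sym
      unfolding parts_defs by blast
  qed
  then show "k \<in> only1 \<Longrightarrow> \<not> k \<sim> z" .
  obtain x where x: "x \<in> only1"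
  proof -
    obtain x where x: "x \<in> K" "d \<sim> x" "x \<sim> a" using dominated[of a] ab by (auto simp: parts_defs)
    then have "x \<sim> b" using absorb[of x a b] ab by (auto simp: parts_defs)
    then have "\<not> d' \<sim> x" using no_K4[of d' a b x] x ab sym by (auto simp: parts_defs)
    then show thesis using that x by (auto simp: parts_defs)
  qed
  show "\<not> k \<sim> z" if k: "k \<in> only2"
  proof
    assume kz: "k \<sim> z"
    have "\<not> x \<sim> k"
      using A[OF x] absorb[of x k z] x z k kz by (auto simp: parts_defs)
    then show False
      using no_P6[of z k d' q d x] A[OF x] x k z kz qd qK other.qd dd' sym
      unfolding parts_defs by blast
  qed
qed

text \<open>The isolated vertices of \<open>only1\<close>, \<open>only2\<close>, \<open>both\<close> and \<open>neither\<close> get the colours \<open>0\<close>, \<open>1\<close>,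
  \<open>2\<close> and \<open>1\<close>; one end of each matching edge keeps this colour, and the other end gets \<open>2\<close>, \<open>2\<close>,
  \<open>0\<close> and \<open>0\<close>, respectively. Between two different parts, equal colours could only occur at edges
  that the preceding lemmas exclude.\<close>

lemma three_colouring_seen_edge:
  assumes ab: "a \<in> only2" "b \<in> only2" "a \<sim> b"
  shows "\<exists>c :: 'a \<Rightarrow> nat. (\<forall>x\<in>K. c x < 3) \<and> (\<forall>x\<in>K. \<forall>y\<in>K. x \<sim> y \<longrightarrow> c x \<noteq> c y)"
proof -
  interpret swap: two_roots adj p q d' d K by (rule swap)
  have sw: "swap.only1 = only2" "swap.both = both"
    by (auto simp: parts_defs swap.parts_defs)
  obtain f1 :: "'a \<Rightarrow> bool" where f1: "\<forall>x\<in>only1. \<forall>y\<in>only1. x \<sim> y \<longrightarrow> f1 x \<noteq> f1 y"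
    "\<forall>x\<in>only1. f1 x \<longrightarrow> \<not> single only1 x"
    using part_2_colouring[OF matching_parts(2)] by blast
  obtain f2 :: "'a \<Rightarrow> bool" where f2: "\<forall>x\<in>only2. \<forall>y\<in>only2. x \<sim> y \<longrightarrow> f2 x \<noteq> f2 y"
    "\<forall>x\<in>only2. f2 x \<longrightarrow> \<not> single only2 x"
    using part_2_colouring[OF matching_parts(3)] by blast
  obtain g :: "'a \<Rightarrow> bool" where g: "\<forall>x\<in>both. \<forall>y\<in>both. x \<sim> y \<longrightarrow> g x \<noteq> g y"
    "\<forall>x\<in>both. g x \<longrightarrow> \<not> single both x"
    using part_2_colouring[OF matching_parts(1)] by blast
  obtain h :: "'a \<Rightarrow> bool" where h: "\<forall>x\<in>neither. \<forall>y\<in>neither. x \<sim> y \<longrightarrow> h x \<noteq> h y"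
    "\<forall>x\<in>neither. h x \<longrightarrow> \<not> single neither x"
    using part_2_colouring[OF matching_parts(4)] by blast
  define c :: "'a \<Rightarrow> nat" where "c x = (if x \<in> only1 then (if f1 x then 2 else 0)
    else if x \<in> only2 then (if f2 x then 2 else 1)
    else if x \<in> both then (if g x then 0 else 2) else (if h x then 0 else 1))" for x
  have c: "x \<in> only1 \<Longrightarrow> c x = (if f1 x then 2 else 0)"
    "x \<in> only2 \<Longrightarrow> c x = (if f2 x then 2 else 1)"
    "x \<in> both \<Longrightarrow> c x = (if g x then 0 else 2)"
    "x \<in> neither \<Longrightarrow> c x = (if h x then 0 else 1)" for x
    by (auto simp: c_def parts_defs)
  have parts: "x \<in> only1 \<or> x \<in> only2 \<or> x \<in> both \<or> x \<in> neither" if "x \<in> K" for x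
    using that by (auto simp: parts_defs)
  have same: "x \<in> only1 \<Longrightarrow> y \<in> only1 \<Longrightarrow> x \<sim> y \<Longrightarrow> c x \<noteq> c y"
    "x \<in> only2 \<Longrightarrow> y \<in> only2 \<Longrightarrow> x \<sim> y \<Longrightarrow> c x \<noteq> c y"
    "x \<in> both \<Longrightarrow> y \<in> both \<Longrightarrow> x \<sim> y \<Longrightarrow> c x \<noteq> c y"
    "x \<in> neither \<Longrightarrow> y \<in> neither \<Longrightarrow> x \<sim> y \<Longrightarrow> c x \<noteq> c y" for x y
    using f1(1) f2(1) g(1) h(1) by (auto simp: c)
  have diff: "x \<in> only1 \<Longrightarrow> y \<in> only2 \<Longrightarrow> x \<sim> y \<Longrightarrow> c x \<noteq> c y"
    "x \<in> only1 \<Longrightarrow> y \<in> both \<Longrightarrow> x \<sim> y \<Longrightarrow> c x \<noteq> c y"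
    "x \<in> only2 \<Longrightarrow> y \<in> both \<Longrightarrow> x \<sim> y \<Longrightarrow> c x \<noteq> c y"
    "x \<in> neither \<Longrightarrow> y \<in> both \<Longrightarrow> x \<sim> y \<Longrightarrow> c x \<noteq> c y" for x y
    using f1(2) f2(2) g(2) h(2) only1_only2_not_both_paired[of x y]
      single_only1_if_adj_both[of x y] swap.single_only1_if_adj_both[of x y]
      neither_both_not_both_paired[of x y]
    by (auto simp: c sw single_def swap.single_def)
  have none: "x \<in> only1 \<Longrightarrow> z \<in> neither \<Longrightarrow> \<not> x \<sim> z"
    "x \<in> only2 \<Longrightarrow> z \<in> neither \<Longrightarrow> \<not> x \<sim> z" for x z
    using not_adj_neither[OF ab] by auto
  have proper: "c x \<noteq> c y" if "x \<in> K" "y \<in> K" "x \<sim> y" for x y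
    using parts[OF that(1)] parts[OF that(2)] that(3) sym[OF that(3)]
      same[of x y] diff[of x y] diff[of y x] none[of x y] none[of y x]
    by metis
  have "c x < 3" for x by (simp add: c_def)
  then show ?thesis using proper by blast
qed

end

section \<open>Assembling the colouring\<close>

context P6_dart_K4_free_adj
begin

text \<open>No neighbour of \<open>D\<close> gets colour \<open>3\<close>, which stays available for \<open>D\<close>.\<close>

lemma colouring_attached_component:
  fixes D :: "'a set"
  assumes pq: "p \<sim> q" and qD: "\<And>d. d \<in> D \<Longrightarrow> q \<sim> d" and pD: "\<And>d. d \<in> D \<Longrightarrow> \<not> p \<sim> d"
    and indep: "\<And>d d'. d \<in> D \<Longrightarrow> d' \<in> D \<Longrightarrow> \<not> d \<sim> d'"
    and pqK: "\<And>k. k \<in> K \<Longrightarrow> \<not> p \<sim> k" "\<And>k. k \<in> K \<Longrightarrow> \<not> q \<sim> k"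
    and conn: "connected_on adj K"
    and touch: "\<exists>d\<in>D. \<exists>k\<in>K. d \<sim> k"
  shows "\<exists>c :: 'a \<Rightarrow> nat. (\<forall>x\<in>K. c x < 4 \<and> ((\<exists>d\<in>D. d \<sim> x) \<longrightarrow> c x < 3)) \<and>
    (\<forall>x\<in>K. \<forall>y\<in>K. x \<sim> y \<longrightarrow> c x \<noteq> c y)"
proof -
  obtain d k0 where d: "d \<in> D" "k0 \<in> K" "d \<sim> k0" using touch by blast
  have rooted: "rooted_component adj p q e K" if "e \<in> D" "k \<in> K" "e \<sim> k" for e k
    by unfold_locales (use that pq qD pD pqK conn in auto)
  interpret rooted_component adj p q d K by (rule rooted[OF d])
  let ?M = "{x. \<exists>e\<in>D. e \<sim> x}"
  show ?thesis
  proof (cases "\<exists>a\<in>K. \<exists>b\<in>K. \<not> d \<sim> a \<and> \<not> d \<sim> b \<and> a \<in> ?M \<and> b \<in> ?M \<and> a \<sim> b")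
    case True
    then obtain a b e where ab: "a \<in> K" "b \<in> K" "\<not> d \<sim> a" "\<not> d \<sim> b" "a \<sim> b" "e \<in> D" "e \<sim> a"
      by blast
    have "rooted_component adj p q e K" using rooted ab by blast
    then interpret two_roots adj p q d e K
      unfolding two_roots_def two_roots_axioms_def
      using rooted_component_axioms indep d ab by auto
    have "\<exists>c :: 'a \<Rightarrow> nat. (\<forall>x\<in>K. c x < 3) \<and> (\<forall>x\<in>K. \<forall>y\<in>K. x \<sim> y \<longrightarrow> c x \<noteq> c y)"
    proof (cases "e \<sim> b")
      case True
      then show ?thesis
        by (intro three_colouring_seen_edge[of a b]) (use ab in \<open>auto simp: only2_def\<close>)
    next
      case False
      then show ?thesis by (intro three_colouring_half_seen_edge[of a b]) (use ab in auto)
    qed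
    then obtain c :: "'a \<Rightarrow> nat" where c: "\<forall>x\<in>K. c x < 3" "\<forall>x\<in>K. \<forall>y\<in>K. x \<sim> y \<longrightarrow> c x \<noteq> c y"
      by blast
    then have "\<forall>x\<in>K. c x < 4" by force
    then show ?thesis using c by blast
  next
    case False
    then show ?thesis using four_colouring[of ?M] by auto
  qed
qed

text \<open>The assumption \<open>far\<close> provides a root for the components of \<open>R\<close> that have no neighbour in \<open>D\<close>;
  for them the roles of \<open>p\<close> and \<open>q\<close> are exchanged.\<close>

lemma colouring_rest:
  fixes D R :: "'a set"
  assumes pq: "p \<sim> q" and qD: "\<And>d. d \<in> D \<Longrightarrow> q \<sim> d" and pD: "\<And>d. d \<in> D \<Longrightarrow> \<not> p \<sim> d"
    and indep: "\<And>d d'. d \<in> D \<Longrightarrow> d' \<in> D \<Longrightarrow> \<not> d \<sim> d'"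
    and pqR: "\<And>k. k \<in> R \<Longrightarrow> \<not> p \<sim> k" "\<And>k. k \<in> R \<Longrightarrow> \<not> q \<sim> k"
    and far: "\<And>K. \<lbrakk>K \<subseteq> R; K \<noteq> {}; \<And>x y. x \<in> K \<Longrightarrow> y \<in> R \<Longrightarrow> x \<sim> y \<Longrightarrow> y \<in> K;
      \<And>d k. d \<in> D \<Longrightarrow> k \<in> K \<Longrightarrow> \<not> d \<sim> k\<rbrakk> \<Longrightarrow> \<exists>s k. k \<in> K \<and> s \<sim> k \<and> p \<sim> s \<and> \<not> q \<sim> s"
  shows "\<exists>c :: 'a \<Rightarrow> nat. (\<forall>x\<in>R. c x < 4 \<and> ((\<exists>d\<in>D. d \<sim> x) \<longrightarrow> c x < 3)) \<and>
    (\<forall>x\<in>R. \<forall>y\<in>R. x \<sim> y \<longrightarrow> c x \<noteq> c y)"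
proof (rule colouring_by_components[OF sym])
  fix K assume K: "K \<subseteq> R" "K \<noteq> {}" "connected_on adj K"
    and closed: "\<And>x y. x \<in> K \<Longrightarrow> y \<in> R \<Longrightarrow> x \<sim> y \<Longrightarrow> y \<in> K"
  show "\<exists>c :: 'a \<Rightarrow> nat. (\<forall>x\<in>K. c x < 4 \<and> ((\<exists>d\<in>D. d \<sim> x) \<longrightarrow> c x < 3)) \<and>
    (\<forall>x\<in>K. \<forall>y\<in>K. x \<sim> y \<longrightarrow> c x \<noteq> c y)"
  proof (cases "\<exists>d\<in>D. \<exists>k\<in>K. d \<sim> k")
    case True
    then show ?thesis
      using K pqR by (intro colouring_attached_component[OF pq qD pD indep]) auto
  next
    case False
    then have "\<exists>s k. k \<in> K \<and> s \<sim> k \<and> p \<sim> s \<and> \<not> q \<sim> s"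
      by (intro far[OF K(1,2)]) (auto intro: closed)
    then obtain s k where s: "k \<in> K" "s \<sim> k" "p \<sim> s" "\<not> q \<sim> s" by blast
    interpret rooted_component adj q p s K
      by unfold_locales (use s K pqR pq sym in auto)
    show ?thesis using four_colouring[of "{}"] False by auto
  qed
qed

text \<open>Let the adjacent vertices \<open>x\<close> and \<open>y\<close> have three pairwise nonadjacent common neighbours \<open>v\<close>,
  \<open>w\<close> and \<open>b\<close>, and let \<open>s\<close> see \<open>x\<close> but not \<open>y\<close>. If \<open>s\<close> sees neither \<open>v\<close> nor \<open>w\<close>, then it is
  pendant on the diamond \<open>x, y, v, w\<close>. If it sees \<open>v\<close> only, then either \<open>s\<close> is pendant on the
  diamond \<open>x, y, b, w\<close>, or \<open>s\<close> sees \<open>b\<close> and \<open>w\<close> is pendant on the diamond \<open>x, s, v, b\<close>;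
  likewise if it sees \<open>w\<close> only.\<close>

lemma centre_nbr_adj_leaves:
  assumes "x \<sim> y" "x \<sim> v" "y \<sim> v" "x \<sim> w" "y \<sim> w" "\<not> v \<sim> w" "v \<noteq> w"
    and b: "b \<sim> x" "b \<sim> y" "\<not> b \<sim> v" "\<not> b \<sim> w" "b \<noteq> v" "b \<noteq> w"
    and s: "s \<sim> x" "\<not> s \<sim> y"
  shows "s \<sim> v \<and> s \<sim> w"
proof -
  have "s \<sim> v \<or> s \<sim> w"
    using no_dart[of x y v w s] assms by (metis sym)
  moreover have False if "s \<sim> v" "\<not> s \<sim> w"
    using no_dart[of x y b w s] no_dart[of x s v b w] that assms by (metis sym)
  moreover have False if "s \<sim> w" "\<not> s \<sim> v"
    using no_dart[of x y b v s] no_dart[of x s w b v] that assms by (metis sym)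
  ultimately show ?thesis by blast
qed

end

section \<open>From digraphs to adjacency relations\<close>

lemma induced_embedding_not_free:
  assumes "pair_graph G" and arcs: "parcs F \<subseteq> pverts F \<times> pverts F"
    and inj: "inj_on f (pverts F)" and sub: "f ` pverts F \<subseteq> pverts G"
    and adj: "\<And>x y. x \<in> pverts F \<Longrightarrow> y \<in> pverts F \<Longrightarrow> (x, y) \<in> parcs F \<longleftrightarrow> (f x, f y) \<in> parcs G"
  shows "\<not> induced_free F G"
proof -
  interpret pair_graph G by fact
  let ?S = "f ` pverts F"
  let ?g = "the_inv_into (pverts F) f"
  let ?H = "with_proj G \<restriction> ?S"
  let ?h = "\<lparr>iso_verts = ?g, iso_arcs = map_prod ?g ?g, iso_head = snd, iso_tail = fst\<rparr>"
  have ind: "induced_subgraph ?H (with_proj G)" using induced_induce[of ?S] sub by simp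
  have gf: "?g (f x) = x" if "x \<in> pverts F" for x using the_inv_into_f_f[OF inj that] .
  have injg: "inj_on ?g ?S" by (rule inj_on_the_inv_into[OF inj])
  have "pre_digraph.digraph_isomorphism ?H ?h"
    unfolding pre_digraph.digraph_isomorphism_def
  proof (intro conjI)
    show "wf_digraph ?H" by blast
    show "inj_on (iso_verts ?h) (verts ?H)" using injg by simp
    show "inj_on (iso_arcs ?h) (arcs ?H)"
      by (simp, rule inj_on_subset[OF map_prod_inj_on[OF injg injg]]) auto
  qed auto
  moreover have "with_proj F = app_iso ?h ?H"
  proof -
    have "parcs F = map_prod ?g ?g ` {e \<in> parcs G. fst e \<in> ?S \<and> snd e \<in> ?S}"
    proof (intro set_eqI iffI)
      fix e assume e: "e \<in> parcs F"
      then obtain x y where xy: "e = (x, y)" "x \<in> pverts F" "y \<in> pverts F" using arcs by auto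
      then have "e = map_prod ?g ?g (f x, f y)" by (simp add: gf)
      moreover have "(f x, f y) \<in> parcs G" using adj xy e by simp
      ultimately show "e \<in> map_prod ?g ?g ` {e \<in> parcs G. fst e \<in> ?S \<and> snd e \<in> ?S}"
        using xy by (intro image_eqI[of _ _ "(f x, f y)"]) auto
    qed (auto simp: gf adj)
    moreover have "pverts F = ?g ` ?S" by (auto simp: gf image_image)
    ultimately show ?thesis by (simp add: app_iso_def with_proj_def induce_subgraph_def)
  qed
  ultimately show ?thesis
    using ind unfolding induced_free_def digraph_iso_def by blast
qed

lemma parcs_graph_of: "parcs (graph_of V E) = E \<union> E\<inverse>"
  by (auto simp: graph_of_def parcs_mk_symmetric)

lemma pverts_graph_of: "pverts (graph_of V E) = V"
  by (simp add: graph_of_def)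

lemma P6_dart_K4_free_adjI:
  assumes G: "pair_graph G" and free: "P6_dart_K4_free G"
  shows "P6_dart_K4_free_adj (\<lambda>x y. (x, y) \<in> parcs G)"
proof -
  interpret pair_graph G by fact
  let ?E = "\<lambda>x y. (x, y) \<in> parcs G"
  have sym: "?E y x" if "?E x y" for x y using arcs_symmetric that .
  have nsym: "\<not> ?E y x" if "\<not> ?E x y" for x y using sym that by blast
  have irr: "\<not> ?E x x" for x using no_loops'[of x x] by blast
  have V: "x \<in> pverts G \<and> y \<in> pverts G" if "?E x y" for x y using that in_arcsD1 in_arcsD2 by blast
  show ?thesis
  proof
    fix a b c d e f
    assume E: "?E a b" "?E b c" "?E c d" "?E d e" "?E e f"
      and N: "\<not> ?E a c" "\<not> ?E a d" "\<not> ?E a e" "\<not> ?E a f" "\<not> ?E b d" "\<not> ?E b e" "\<not> ?E b f"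
        "\<not> ?E c e" "\<not> ?E c f" "\<not> ?E d f"
    note E' = E[THEN sym] and N' = N[THEN nsym]
    let ?f = "nth [a, b, c, d, e, f]"
    have dist: "distinct [a, b, c, d, e, f]" using E E' N irr by auto
    have six: "{0..<6} = {0, 1, 2, 3, 4, 5 :: nat}" by auto
    have P: "pverts (path_graph 6) = {0..<6}" by (simp add: path_graph_def pverts_graph_of)
    have A: "parcs (path_graph 6) = {(i, j). i < 6 \<and> j < 6 \<and> (j = Suc i \<or> i = Suc j)}"
      by (auto simp: path_graph_def parcs_graph_of)
    have "\<not> induced_free (path_graph 6) G"
    proof (rule induced_embedding_not_free[OF G, of _ ?f])
      show "parcs (path_graph 6) \<subseteq> pverts (path_graph 6) \<times> pverts (path_graph 6)"
        unfolding P A by auto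
      show "inj_on ?f (pverts (path_graph 6))"
        unfolding P using dist by (intro inj_on_nth) auto
      show "?f ` pverts (path_graph 6) \<subseteq> pverts G"
        unfolding P six using V E by auto
      show "(x, y) \<in> parcs (path_graph 6) \<longleftrightarrow> ?E (?f x) (?f y)"
        if "x \<in> pverts (path_graph 6)" "y \<in> pverts (path_graph 6)" for x y
        using that unfolding P six A by (elim insertE emptyE) (simp_all add: E E' N N' irr)
    qed
    then show False using free by (simp add: P6_dart_K4_free_def)
  next
    fix p q r s t
    assume E: "?E p q" "?E p r" "?E p s" "?E q r" "?E q s" "?E p t"
      and N: "r \<noteq> s" "\<not> ?E r s" "\<not> ?E t q" "\<not> ?E t r" "\<not> ?E t s"
    note E' = E[THEN sym] and N' = N(2-)[THEN nsym]
    \<comment> \<open>the vertices of degree 3 of the diamond in \<^const>\<open>dart_graph\<close> are \<open>0\<close> and \<open>2\<close>, with \<open>4\<close> attached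
      to \<open>0\<close>\<close>
    let ?f = "nth [p, r, q, s, t]"
    have dist: "distinct [p, r, q, s, t]" using E E' N irr by auto
    have P: "pverts dart_graph = {0, 1, 2, 3, 4}"
      by (auto simp: dart_graph_def diamond_graph_def pverts_graph_of)
    let ?A = "{(0, 1), (1, 2), (2, 3), (3, 0), (0, 2), (4, 0)} :: (nat \<times> nat) set"
    have A: "parcs dart_graph = ?A \<union> ?A\<inverse>"
      by (auto simp: dart_graph_def diamond_graph_def parcs_graph_of)
    have "\<not> induced_free dart_graph G"
    proof (rule induced_embedding_not_free[OF G, of _ ?f])
      show "parcs dart_graph \<subseteq> pverts dart_graph \<times> pverts dart_graph"
        unfolding P A by auto
      show "inj_on ?f (pverts dart_graph)"
        unfolding P using dist by (intro inj_on_nth) auto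
      show "?f ` pverts dart_graph \<subseteq> pverts G"
        unfolding P using V E by auto
      show "(x, y) \<in> parcs dart_graph \<longleftrightarrow> ?E (?f x) (?f y)"
        if "x \<in> pverts dart_graph" "y \<in> pverts dart_graph" for x y
        using that unfolding P A by (elim insertE emptyE) (simp_all add: E E' N N' irr)
    qed
    then show False using free by (simp add: P6_dart_K4_free_def)
  next
    fix p q r s
    assume E: "?E p q" "?E p r" "?E p s" "?E q r" "?E q s" "?E r s"
    note E' = E[THEN sym]
    have dist: "distinct [p, q, r, s]" using E irr by auto
    let ?S = "{p, q, r, s}"
    let ?H = "\<lparr>pverts = ?S, parcs = {(u, v). u \<in> ?S \<and> v \<in> ?S \<and> u \<noteq> v}\<rparr>"
    have "complete_digraph 4 (with_proj ?H)"
      unfolding complete_digraph_pair_def using dist by auto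
    moreover have "induced_subgraph (with_proj ?H) (with_proj G)"
    proof -
      have "parcs ?H = {e \<in> parcs G. fst e \<in> ?S \<and> snd e \<in> ?S}" using E E' irr by auto
      moreover have "?S \<subseteq> pverts G" using E V by auto
      moreover have "wf_digraph (with_proj ?H)" by unfold_locales auto
      ultimately show ?thesis
        unfolding induced_subgraph_def subgraph_def
        using wf_digraph_axioms by (auto simp: compatible_def)
    qed
    ultimately show False using free unfolding P6_dart_K4_free_def by blast
  qed (use sym irr in auto)
qed

lemma connected_imp_connected_on:
  assumes G: "pair_graph G" and con: "Digraph_Component.connected (with_proj G)"
  shows "connected_on (\<lambda>x y. (x, y) \<in> parcs G) (pverts G)"
  unfolding connected_on_def
proof (intro allI impI)
  interpret pair_graph G by fact
  fix A assume A: "A \<subseteq> pverts G" "A \<noteq> {}" "\<forall>x\<in>A. \<forall>y\<in>pverts G. (x, y) \<in> parcs G \<longrightarrow> y \<in> A"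
  then obtain a where a: "a \<in> A" by blast
  have "v \<in> A" if "v \<in> pverts G" for v
  proof -
    have "a \<rightarrow>\<^sup>*\<^bsub>mk_symmetric (with_proj G)\<^esub> v"
      using con a A(1) that unfolding connected_def strongly_connected_def by auto
    then have "a \<rightarrow>\<^sup>*\<^bsub>with_proj G\<^esub> v"
      using reachable_mk_symmetric_eq[OF sym_arcs] by simp
    then show ?thesis
    proof (induction rule: reachable_induct)
      case (step x y)
      then show ?case using A(3) in_arcsD2 by auto
    qed (use a in simp)
  qed
  then show "A = pverts G" using A(1) by blast
qed

theorem lemma2p8:
  fixes G H :: "'a pair_pre_digraph"
    and u1 u2 u3 u4 :: 'a
    and A2 B13 C2 C4 Z W :: "'a set"
  assumes "pair_graph G"
    and "Digraph_Component.connected (with_proj G)"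
    and "P6_dart_K4_free G"
    and "\<not> (\<exists>K. clique_cutset G K)"
    and "distinct [u1, u2, u3, u4]"
    and "H = diamond_graph u1 u2 u3 u4"
    and "induced_subgraph (with_proj H) (with_proj G)"
    and "A2 = attached G H {u2}"
    and "B13 = attached G H {u1, u3}"
    and "C2 = attached G H {u2, u3, u4}"
    and "C4 = attached G H {u4, u1, u2}"
    and "Z = attached G H {}"
    and "C2 = {}" and "C4 = {}" and "B13 \<noteq> {}"
    and "W = pverts H \<union> A2 \<union> B13 \<union> Z"
  shows "colorable 4 (induce_subgraph (with_proj G) W)"
proof -
  interpret pair_graph G by fact
  define E where "E = (\<lambda>x y. (x, y) \<in> parcs G)"
  interpret P6_dart_K4_free_adj E
    unfolding E_def by (rule P6_dart_K4_free_adjI) fact+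
  have PH: "pverts H = {u1, u2, u3, u4}"
    using assms(6) by (simp add: diamond_graph_def pverts_graph_of)
  have AH: "(x, y) \<in> parcs H \<longleftrightarrow> E x y" if "x \<in> pverts H" "y \<in> pverts H" for x y
    using assms(7) that by (auto simp: induced_subgraph_def E_def)
  have HG: "pverts H \<subseteq> pverts G"
    using assms(7) by (auto simp: induced_subgraph_def subgraph_def)
  have diamond: "E u1 u2" "E u2 u3" "E u3 u4" "E u4 u1" "E u1 u3" "\<not> E u2 u4"
    using AH[unfolded PH] assms(5,6) by (auto simp: diamond_graph_def parcs_graph_of)
  note diamond' = diamond(1-5)[THEN sym]
  have att: "x \<in> attached G H S \<longleftrightarrow> x \<in> pverts G \<and> x \<notin> {u1, u2, u3, u4} \<and>
    (\<forall>u \<in> {u1, u2, u3, u4}. E x u \<longleftrightarrow> u \<in> S)" if "S \<subseteq> {u1, u2, u3, u4}" for x S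
    using that unfolding attached_def nbhd_def PH E_def by blast
  have A2: "x \<in> A2 \<longleftrightarrow> x \<in> pverts G \<and> x \<notin> {u1, u2, u3, u4} \<and>
    \<not> E x u1 \<and> E x u2 \<and> \<not> E x u3 \<and> \<not> E x u4" for x
    using assms(5) unfolding assms(8) by (subst att) auto
  have Z: "x \<in> Z \<longleftrightarrow> x \<in> pverts G \<and> x \<notin> {u1, u2, u3, u4} \<and>
    \<not> E x u1 \<and> \<not> E x u2 \<and> \<not> E x u3 \<and> \<not> E x u4" for x
    using assms(5) unfolding assms(12) by (subst att) auto
  have B13: "x \<in> B13 \<longleftrightarrow> x \<in> pverts G \<and> x \<notin> {u1, u2, u3, u4} \<and>
    E x u1 \<and> \<not> E x u2 \<and> E x u3 \<and> \<not> E x u4" for x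
    using assms(5) unfolding assms(9) by (subst att) auto
  have C2: "\<not> (x \<in> pverts G \<and> x \<notin> {u1, u2, u3, u4} \<and>
    \<not> E x u1 \<and> E x u2 \<and> E x u3 \<and> E x u4)" for x
    using assms(5,13) att[of "{u2, u3, u4}" x] unfolding assms(10) by auto
  have C4: "\<not> (x \<in> pverts G \<and> x \<notin> {u1, u2, u3, u4} \<and>
    E x u1 \<and> E x u2 \<and> \<not> E x u3 \<and> E x u4)" for x
    using assms(5,14) att[of "{u4, u1, u2}" x] unfolding assms(11) by auto
  obtain b where b: "b \<in> B13" using assms(15) by blast

  define D where "D = insert u2 B13"
  define R where "R = A2 \<union> Z"
  have D: "E u1 d" "E u3 d" "\<not> E u4 d" if "d \<in> D" for d
    using that diamond diamond' by (auto simp: D_def B13 sym_iff[of _ d])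
  have indep: "\<not> E d d'" if "d \<in> D" "d' \<in> D" for d d'
    using no_K4[of u1 u3 d d'] D that diamond(5) by blast
  have R: "\<not> E u1 r" "\<not> E u3 r" "\<not> E u4 r" if "r \<in> R" for r
    using that by (auto simp: R_def A2 Z sym_iff[of _ r])

  \<comment> \<open>As \<open>u2, u4, b\<close> are common neighbours of \<open>u1, u3\<close>, a neighbour of \<open>u1\<close> or \<open>u3\<close> outside the
    diamond and \<open>D\<close> cannot exist: it would lie in \<open>C2\<close> or \<open>C4\<close> if it sees only one of \<open>u1, u3\<close>, and
    it would lie in \<open>B13\<close> or in a \<open>K\<^sub>4\<close> if it sees both.\<close>
  have outer: "E u4 s \<and> \<not> E u1 s"
    if s: "s \<in> pverts G" "s \<notin> {u1, u3, u4}" "s \<notin> D" "s \<notin> R" for s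
  proof -
    have s': "s \<notin> {u1, u2, u3, u4}" using s by (auto simp: D_def)
    have 1: "E s u3" if "E s u1"
    proof (rule ccontr)
      assume "\<not> E s u3"
      then have "E s u2 \<and> E s u4"
        by (intro centre_nbr_adj_leaves[of u1 u3 u2 u4 b s])
          (use diamond diamond' assms(5) b B13 that in auto)
      then show False using C4[of s] s s' that \<open>\<not> E s u3\<close> by blast
    qed
    have 3: "E s u1" if "E s u3"
    proof (rule ccontr)
      assume "\<not> E s u1"
      then have "E s u2 \<and> E s u4"
        by (intro centre_nbr_adj_leaves[of u3 u1 u2 u4 b s])
          (use diamond diamond' assms(5) b B13 that in auto)
      then show False using C2[of s] s s' that \<open>\<not> E s u1\<close> by blast
    qed
    have "\<not> E s u1"
    proof
      assume "E s u1"
      moreover have "\<not> E s u2" using no_K4[of s u1 u2 u3] 1 calculation diamond by blast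
      moreover have "\<not> E s u4" using no_K4[of s u1 u3 u4] 1 \<open>E s u1\<close> diamond diamond' by blast
      ultimately show False using 1 B13 s s' by (auto simp: D_def)
    qed
    then show ?thesis using 3 s s' by (auto simp: R_def A2 Z sym_iff[of _ s])
  qed

  have "\<exists>c :: 'a \<Rightarrow> nat. (\<forall>x\<in>R. c x < 4 \<and> ((\<exists>d\<in>D. E d x) \<longrightarrow> c x < 3)) \<and>
    (\<forall>x\<in>R. \<forall>y\<in>R. E x y \<longrightarrow> c x \<noteq> c y)"
  proof (rule colouring_rest[of u4 u1])
    fix K assume K: "K \<subseteq> R" "K \<noteq> {}"
      and closed: "\<And>x y. x \<in> K \<Longrightarrow> y \<in> R \<Longrightarrow> E x y \<Longrightarrow> y \<in> K"
      and noD: "\<And>d k. d \<in> D \<Longrightarrow> k \<in> K \<Longrightarrow> \<not> E d k"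
    have "u1 \<in> pverts G" "u1 \<notin> R" using HG PH A2 Z by (auto simp: R_def)
    then have "K \<noteq> pverts G" using K by blast
    moreover have "K \<subseteq> pverts G" using K A2 Z by (auto simp: R_def)
    ultimately obtain k s where ks: "k \<in> K" "s \<in> pverts G" "E k s" "s \<notin> K"
      using connected_onD[OF connected_imp_connected_on[OF assms(1,2), folded E_def], of K] K(2)
      by blast
    have "s \<notin> {u1, u3, u4}" using R[of k] K(1) ks sym by blast
    moreover have "s \<notin> D" using noD ks sym by blast
    moreover have "s \<notin> R" using closed ks by blast
    ultimately have "E u4 s \<and> \<not> E u1 s" using outer ks by blast
    then show "\<exists>s k. k \<in> K \<and> E s k \<and> E u4 s \<and> \<not> E u1 s" using ks sym by blast
  qed (use diamond D indep R in auto)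
  then obtain c :: "'a \<Rightarrow> nat" where c: "\<forall>x\<in>R. c x < 4" "\<forall>d\<in>D. \<forall>x\<in>R. E d x \<longrightarrow> c x < 3"
    "\<forall>x\<in>R. \<forall>y\<in>R. E x y \<longrightarrow> c x \<noteq> c y"
    by blast

  define col :: "'a \<Rightarrow> nat" where
    "col v = (if v = u1 then 0 else if v = u3 then 1 else if v \<in> insert u4 D then 3 else c v)" for v
  have notin: "u1 \<notin> D" "u3 \<notin> D" "u1 \<notin> R" "u3 \<notin> R" "u4 \<notin> R" "D \<inter> R = {}"
    using assms(5) A2 B13 Z by (auto simp: D_def R_def)
  have col: "col u1 = 0" "col u3 = 1" "v \<in> insert u4 D \<Longrightarrow> col v = 3" "v \<in> R \<Longrightarrow> col v = c v" for v
    using notin assms(5) by (auto simp: col_def)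
  have W: "v = u1 \<or> v = u3 \<or> v \<in> insert u4 D \<or> v \<in> R" if "v \<in> W" for v
    using that unfolding assms(16) PH by (auto simp: D_def R_def)
  have proper: "col x \<noteq> col y" if "x \<in> W" "y \<in> W" "E x y" for x y
  proof -
    have ind4: "\<not> E v w" if "v \<in> insert u4 D" "w \<in> insert u4 D" for v w
      using that D indep irrefl sym by blast
    have DR: "col v \<noteq> col w" if "v \<in> insert u4 D" "w \<in> R" "E v w" for v w
      using that R c(2) col by force
    show ?thesis
      using W[OF that(1)] W[OF that(2)] that(3) sym[OF that(3)] irrefl
        ind4[of x y] DR[of x y] DR[of y x] R[of x] R[of y] c(3) col(1,2) col(3,4)[of x] col(3,4)[of y]
      by (elim disjE) auto
  qed
  show ?thesis
    unfolding colorable_def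
  proof (intro exI[of _ col] conjI ballI)
    show "col ` verts (with_proj G \<restriction> W) \<subseteq> {0..<4}"
      using W c(1) col by (fastforce simp: image_subset_iff)
    fix e assume "e \<in> arcs (with_proj G \<restriction> W)"
    then show "col (tail (with_proj G \<restriction> W) e) \<noteq> col (head (with_proj G \<restriction> W) e)"
      using proper[of "fst e" "snd e"] by (auto simp: E_def)
  qed
qed

end
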